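(* Let $\alpha\in(0,1)$. The Teichmüller space $T_0^\alpha=\mathrm{Diff}^{1+\alpha}_*(\mathbb{S})$ is contractible.
   Context: $\mathbb{S}$ is the unit circle in $\mathbb{C}$. $\mathrm{Diff}^{1+\alpha}(\mathbb{S})$ is the group of orientation-preserving diffeomorphisms $\varphi$ of $\mathbb{S}$ whose derivative is $\alpha$-Hölder continuous, i.e. a lift $\widetilde\varphi:\mathbb{R}\to\mathbb{R}$ with $\exp(i\widetilde\varphi(x))=\varphi(e^{ix})$ satisfies $|\widetilde\varphi'(x)-\widetilde\varphi'(y)|\le c|x-y|^\alpha$ for all $x,y\in\mathbb{R}$ and some constant $c\ge0$. Put $$p_{1+\alpha}(\varphi)=\sup_{\zeta\in\mathbb{S}}|\varphi(\zeta)-\zeta|+\sup_{x\in\mathbb{R}}|\widetilde\varphi'(x)-1|+\sup_{x\neq y}\frac{|\widetilde\varphi'(x)-\widetilde\varphi'(y)|}{|x-y|^\alpha}.$$ The topology is the right uniform one: $\varphi_n\to\varphi$ iff $p_{1+\alpha}(\varphi_n\circ\varphi^{-1})\to0$ (a topological group with this topology). $\mathrm{Diff}^{1+\alpha}_*(\mathbb{S})$ is the subgroup of elements fixing the three points $1,i,-1$, with the subspace topology. *)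

theory Defs
  imports "HOL-Analysis.Analysis"
begin

abbreviation circle :: "complex set" where
  "circle \<equiv> sphere 0 1"

definition is_lift :: "(complex \<Rightarrow> complex) \<Rightarrow> (real \<Rightarrow> real) \<Rightarrow> bool" where
  "is_lift \<phi> g \<longleftrightarrow> continuous_on UNIV g \<and> (\<forall>x. cis (g x) = \<phi> (cis x))"

lemma is_lift_unique:
  assumes "is_lift \<phi> g" "is_lift \<phi> h"
  obtains k :: int where "\<And>x. g x = h x + 2 * pi * of_int k"
proof -
  let ?f = "\<lambda>x. (g x - h x) / (2 * pi)"
  have int: "?f x \<in> \<int>" for x
  proof -
    have "cis (g x) = cis (h x)"
      using assms by (simp add: is_lift_def)
    then have "sin (g x) = sin (h x) \<and> cos (g x) = cos (h x)"
      by (simp add: complex_eq_iff)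
    then obtain n :: int where "g x = h x + 2 * pi * of_int n"
      using sin_cos_eq_iff by blast
    then show ?thesis by simp
  qed
  have "continuous_on UNIV ?f"
    using assms by (auto simp: is_lift_def intro!: continuous_intros)
  moreover have "\<exists>e>0. \<forall>y. y \<in> UNIV \<and> ?f y \<noteq> ?f x \<longrightarrow> e \<le> norm (?f y - ?f x)" for x
  proof (intro exI[of _ 1] conjI allI impI)
    fix y assume y: "y \<in> UNIV \<and> ?f y \<noteq> ?f x"
    obtain m where m: "?f x = of_int m"
      using int[of x] by (rule Ints_cases)
    obtain n where n: "?f y = of_int n"
      using int[of y] by (rule Ints_cases)
    have "m \<noteq> n"
      using y m n by auto
    then have "1 \<le> \<bar>n - m\<bar>" by linarith
    then have "(1::real) \<le> \<bar>of_int n - of_int m\<bar>"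
      by linarith
    then show "1 \<le> norm (?f y - ?f x)"
      unfolding m n by simp
  qed simp
  ultimately have "?f constant_on UNIV"
    by (intro continuous_discrete_range_constant) auto
  then obtain c where c: "\<And>x. ?f x = c"
    unfolding constant_on_def by blast
  have "c \<in> \<int>"
    using int[of 0] unfolding c .
  then obtain k where k: "c = of_int k"
    by (rule Ints_cases)
  have "g x = h x + 2 * pi * of_int k" for x
    using c[of x] k by (simp add: field_simps)
  then show thesis by (rule that)
qed

text \<open>By the previous lemma the derivative of a lift does not depend on the choice made here.\<close>

definition the_lift :: "(complex \<Rightarrow> complex) \<Rightarrow> real \<Rightarrow> real" where
  "the_lift \<phi> = (SOME g. is_lift \<phi> g)"

lemma deriv_the_lift:
  assumes "is_lift \<phi> g"
  shows "deriv (the_lift \<phi>) = deriv g"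
proof -
  have "is_lift \<phi> (the_lift \<phi>)"
    unfolding the_lift_def using assms by (rule someI[of "is_lift \<phi>"])
  then obtain k :: int where k: "\<And>x. the_lift \<phi> x = g x + 2 * pi * of_int k"
    using is_lift_unique assms by blast
  have "(the_lift \<phi> has_field_derivative D) (at x) \<longleftrightarrow> (g has_field_derivative D) (at x)" for x D
  proof
    assume "(the_lift \<phi> has_field_derivative D) (at x)"
    then have "((\<lambda>x. the_lift \<phi> x - 2 * pi * of_int k) has_field_derivative D) (at x)"
      by (auto intro!: derivative_eq_intros)
    then show "(g has_field_derivative D) (at x)"
      by (simp add: k)
  next
    assume "(g has_field_derivative D) (at x)"
    then have "((\<lambda>x. g x + 2 * pi * of_int k) has_field_derivative D) (at x)"
      by (auto intro!: derivative_eq_intros)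
    then show "(the_lift \<phi> has_field_derivative D) (at x)"
      by (simp add: k[abs_def])
  qed
  then show ?thesis
    by (simp add: deriv_def fun_eq_iff)
qed

definition circle_C1 :: "(complex \<Rightarrow> complex) \<Rightarrow> bool" where
  "circle_C1 \<phi> \<longleftrightarrow> (\<exists>g. is_lift \<phi> g \<and> g C1_differentiable_on UNIV)"

definition circle_diffeo :: "(complex \<Rightarrow> complex) \<Rightarrow> bool" where
  "circle_diffeo \<phi> \<longleftrightarrow>
     bij_betw \<phi> circle circle \<and> circle_C1 \<phi> \<and> circle_C1 (inv_into circle \<phi>)"

definition orientation_preserving :: "(complex \<Rightarrow> complex) \<Rightarrow> bool" where
  "orientation_preserving \<phi> \<longleftrightarrow> (\<exists>g. is_lift \<phi> g \<and> strict_mono g)"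

text \<open>Self-maps of the circle are represented by functions on \<^typ>\<open>complex\<close> that are
  \<^const>\<open>undefined\<close> off the circle, so that equality of functions is equality of maps.\<close>

definition Diff_Holder :: "real \<Rightarrow> (complex \<Rightarrow> complex) set" where
  "Diff_Holder \<alpha> = {\<phi> \<in> extensional circle.
     circle_diffeo \<phi> \<and> orientation_preserving \<phi> \<and>
     (\<exists>g c. is_lift \<phi> g \<and> c \<ge> 0 \<and>
        (\<forall>x y. \<bar>deriv g x - deriv g y\<bar> \<le> c * \<bar>x - y\<bar> powr \<alpha>))}"

text \<open>All three suprema are taken over bounded sets when \<open>\<phi> \<in> Diff_Holder \<alpha>\<close>.\<close>

definition p_Holder :: "real \<Rightarrow> (complex \<Rightarrow> complex) \<Rightarrow> real" where
  "p_Holder \<alpha> \<phi> =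
     (SUP \<zeta>\<in>circle. norm (\<phi> \<zeta> - \<zeta>)) +
     (SUP x. \<bar>deriv (the_lift \<phi>) x - 1\<bar>) +
     (SUP (x, y)\<in>{(x, y). x \<noteq> y}.
        \<bar>deriv (the_lift \<phi>) x - deriv (the_lift \<phi>) y\<bar> / \<bar>x - y\<bar> powr \<alpha>)"

text \<open>The right uniform topology: a neighbourhood base at \<open>\<phi>\<close> is given by the sets of all \<open>\<psi>\<close>
  for which \<open>p_Holder \<alpha> (\<psi> \<circ> \<phi>\<inverse>) < \<epsilon>\<close>.\<close>

definition right_uniform_topology :: "real \<Rightarrow> (complex \<Rightarrow> complex) topology" where
  "right_uniform_topology \<alpha> = topology (\<lambda>U. U \<subseteq> Diff_Holder \<alpha> \<and>
     (\<forall>\<phi>\<in>U. \<exists>\<epsilon>>0. \<forall>\<psi>\<in>Diff_Holder \<alpha>.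
        p_Holder \<alpha> (compose circle \<psi> (inv_into circle \<phi>)) < \<epsilon> \<longrightarrow> \<psi> \<in> U))"

lemma openin_right_uniform_topology:
  "openin (right_uniform_topology \<alpha>) U \<longleftrightarrow> U \<subseteq> Diff_Holder \<alpha> \<and>
     (\<forall>\<phi>\<in>U. \<exists>\<epsilon>>0. \<forall>\<psi>\<in>Diff_Holder \<alpha>.
        p_Holder \<alpha> (compose circle \<psi> (inv_into circle \<phi>)) < \<epsilon> \<longrightarrow> \<psi> \<in> U)"
proof -
  let ?P = "\<lambda>U. U \<subseteq> Diff_Holder \<alpha> \<and>
     (\<forall>\<phi>\<in>U. \<exists>\<epsilon>>0. \<forall>\<psi>\<in>Diff_Holder \<alpha>.
        p_Holder \<alpha> (compose circle \<psi> (inv_into circle \<phi>)) < \<epsilon> \<longrightarrow> \<psi> \<in> U)"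
  have "istopology ?P"
    unfolding istopology_def
  proof (rule conjI; intro allI impI)
    fix S T assume S: "?P S" and T: "?P T"
    show "?P (S \<inter> T)"
    proof (intro conjI ballI)
      fix \<phi> assume \<phi>: "\<phi> \<in> S \<inter> T"
      obtain d where d: "d > 0" "\<And>\<psi>. \<psi> \<in> Diff_Holder \<alpha> \<Longrightarrow>
          p_Holder \<alpha> (compose circle \<psi> (inv_into circle \<phi>)) < d \<Longrightarrow> \<psi> \<in> S"
        using S \<phi> by blast
      obtain e where e: "e > 0" "\<And>\<psi>. \<psi> \<in> Diff_Holder \<alpha> \<Longrightarrow>
          p_Holder \<alpha> (compose circle \<psi> (inv_into circle \<phi>)) < e \<Longrightarrow> \<psi> \<in> T"
        using T \<phi> by blast
      show "\<exists>\<epsilon>>0. \<forall>\<psi>\<in>Diff_Holder \<alpha>.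
          p_Holder \<alpha> (compose circle \<psi> (inv_into circle \<phi>)) < \<epsilon> \<longrightarrow> \<psi> \<in> S \<inter> T"
        using d e by (intro exI[of _ "min d e"]) auto
    qed (use S in blast)
  next
    fix K assume K: "\<forall>U\<in>K. ?P U"
    show "?P (\<Union>K)"
    proof (intro conjI ballI)
      fix \<phi> assume "\<phi> \<in> \<Union>K"
      then obtain U where U: "U \<in> K" "\<phi> \<in> U" by blast
      have "?P U"
        using K U(1) by (rule bspec)
      with U(2) obtain e where "e > 0" "\<And>\<psi>. \<psi> \<in> Diff_Holder \<alpha> \<Longrightarrow>
          p_Holder \<alpha> (compose circle \<psi> (inv_into circle \<phi>)) < e \<Longrightarrow> \<psi> \<in> U"
        by blast
      with U(1) show "\<exists>\<epsilon>>0. \<forall>\<psi>\<in>Diff_Holder \<alpha>.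
          p_Holder \<alpha> (compose circle \<psi> (inv_into circle \<phi>)) < \<epsilon> \<longrightarrow> \<psi> \<in> \<Union>K"
        by blast
    next
      show "\<Union>K \<subseteq> Diff_Holder \<alpha>"
      proof (rule Union_least)
        fix U assume "U \<in> K"
        with K have "?P U" by (rule bspec)
        then show "U \<subseteq> Diff_Holder \<alpha>" by (rule conjunct1)
      qed
    qed
  qed
  then show ?thesis
    by (simp add: right_uniform_topology_def topology_inverse')
qed

lemma topspace_right_uniform_topology [simp]:
  "topspace (right_uniform_topology \<alpha>) = Diff_Holder \<alpha>"
proof -
  have "openin (right_uniform_topology \<alpha>) (Diff_Holder \<alpha>)"
    unfolding openin_right_uniform_topology using zero_less_one by blast
  then show ?thesis
    by (metis openin_right_uniform_topology openin_subset openin_topspace subset_antisym)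
qed

definition Diff_Holder_normalized :: "real \<Rightarrow> (complex \<Rightarrow> complex) set" where
  "Diff_Holder_normalized \<alpha> = {\<phi> \<in> Diff_Holder \<alpha>. \<phi> 1 = 1 \<and> \<phi> \<i> = \<i> \<and> \<phi> (-1) = -1}"

definition Teichmuller_space :: "real \<Rightarrow> (complex \<Rightarrow> complex) topology" where
  "Teichmuller_space \<alpha> = subtopology (right_uniform_topology \<alpha>) (Diff_Holder_normalized \<alpha>)"

end

theory Submission
  imports Defs "HOL-Library.Periodic_Fun"
begin

text \<open>
  A circle diffeomorphism that fixes \<open>1\<close> has a unique lift \<open>g\<close> with \<open>g 0 = 0\<close>, and the lifts that
  arise in this way form a convex set: the conditions are \<open>g (x + 2 * pi) = g x + 2 * pi\<close>, a
  derivative bounded below by a positive constant, and Hoelder continuity of the derivative.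
  Fixing \<open>\<i>\<close> and \<open>-1\<close> as well means \<open>g (pi / 2) = pi / 2\<close> and \<open>g pi = pi\<close>, which are affine
  conditions satisfied by the identity. Hence the segment from \<open>g\<close> to the identity,
  \<open>(1 - t) * g x + t * x\<close>, stays among the lifts of normalised diffeomorphisms and gives a candidate
  contraction (\<open>contract\<close>).

  The point that needs work is joint continuity of this homotopy in \<open>t\<close> and the diffeomorphism,
  because the topology is defined by composing with inverses, whereas the segment is additive.
  The two are reconciled by the formula \<open>(g \<circ> f\<inverse>)' - 1 = ((g' - f') / f') \<circ> f\<inverse>\<close> for
  lifts \<open>f\<close> and \<open>g\<close>. For fixed \<open>f\<close>, multiplication by \<open>f'\<close> or by \<open>1 / f'\<close> and composition with the
  bi-Lipschitz map \<open>f\<close> or its inverse change the Hoelder norm by at most a constant factor, so the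
  two derivative terms in \<open>p_Holder\<close> of \<open>\<psi> \<circ> \<phi>\<inverse>\<close>, for the maps \<open>\<phi>\<close> and \<open>\<psi>\<close> lifted by
  \<open>f\<close> and \<open>g\<close>, are small exactly when \<open>g' - f'\<close> has small Hoelder norm
  (\<open>holder_bounded_relative\<close>, \<open>holder_bounded_absolute\<close>). On normalised maps the
  remaining term, the uniform distance, is controlled by integrating \<open>g' - f'\<close> from \<open>0\<close>. The topology
  on the normalised maps is therefore the one given by the Hoelder norm of the difference
  of derivatives (\<open>openin_deriv_ball\<close>, \<open>deriv_ball_in_p_Holder_ball\<close>), and in this norm continuity
  of the segment follows from the triangle inequality (\<open>contract_in_deriv_ball\<close>).
\<close>

section \<open>Bounded Hoelder functions\<close>

text \<open>This says that both the supremum norm and the Hoelder seminorm of \<open>f\<close> are at most \<open>M\<close>. Stated as a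
  predicate, it lets estimates be combined without showing in each step that the sets over which
  suprema are taken are bounded.\<close>

definition holder_bounded :: "real \<Rightarrow> real \<Rightarrow> (real \<Rightarrow> real) \<Rightarrow> bool" where
  "holder_bounded \<alpha> M f \<longleftrightarrow>
     (\<forall>x. \<bar>f x\<bar> \<le> M) \<and> (\<forall>x y. \<bar>f x - f y\<bar> \<le> M * \<bar>x - y\<bar> powr \<alpha>)"

lemma holder_boundedI:
  assumes "\<And>x. \<bar>f x\<bar> \<le> M" "\<And>x y. \<bar>f x - f y\<bar> \<le> M * \<bar>x - y\<bar> powr \<alpha>"
  shows "holder_bounded \<alpha> M f"
  using assms by (simp add: holder_bounded_def)

lemma holder_boundedD:
  assumes "holder_bounded \<alpha> M f"
  shows "\<bar>f x\<bar> \<le> M" "\<bar>f x - f y\<bar> \<le> M * \<bar>x - y\<bar> powr \<alpha>"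
  using assms by (simp_all add: holder_bounded_def)

lemma holder_bounded_nonneg:
  assumes "holder_bounded \<alpha> M f"
  shows "0 \<le> M"
  using holder_boundedD(1)[OF assms, of 0] by linarith

lemma holder_bounded_mono:
  assumes "holder_bounded \<alpha> M f" "M \<le> K"
  shows "holder_bounded \<alpha> K f"
proof (rule holder_boundedI)
  show "\<bar>f x\<bar> \<le> K" for x
    using holder_boundedD(1)[OF assms(1), of x] assms(2) by linarith
  show "\<bar>f x - f y\<bar> \<le> K * \<bar>x - y\<bar> powr \<alpha>" for x y
    using holder_boundedD(2)[OF assms(1), of x y] mult_right_mono[OF assms(2), of "\<bar>x - y\<bar> powr \<alpha>"]
    by simp
qed

lemma holder_bounded_const: "holder_bounded \<alpha> \<bar>c\<bar> (\<lambda>x. c)"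
  by (simp add: holder_bounded_def)

lemma holder_bounded_add:
  assumes "holder_bounded \<alpha> M f" "holder_bounded \<alpha> K g"
  shows "holder_bounded \<alpha> (M + K) (\<lambda>x. f x + g x)"
proof (rule holder_boundedI)
  show "\<bar>f x + g x\<bar> \<le> M + K" for x
    using holder_boundedD(1)[OF assms(1), of x] holder_boundedD(1)[OF assms(2), of x] by linarith
  show "\<bar>(f x + g x) - (f y + g y)\<bar> \<le> (M + K) * \<bar>x - y\<bar> powr \<alpha>" for x y
    using holder_boundedD(2)[OF assms(1), of x y] holder_boundedD(2)[OF assms(2), of x y]
    unfolding distrib_right by linarith
qed

lemma holder_bounded_mult:
  assumes "holder_bounded \<alpha> M f" "holder_bounded \<alpha> K g"
  shows "holder_bounded \<alpha> (2 * M * K) (\<lambda>x. f x * g x)"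
proof (rule holder_boundedI)
  note M = holder_bounded_nonneg[OF assms(1)] and K = holder_bounded_nonneg[OF assms(2)]
  note f = holder_boundedD[OF assms(1)] and g = holder_boundedD[OF assms(2)]
  show "\<bar>f x * g x\<bar> \<le> 2 * M * K" for x
  proof -
    have "\<bar>f x * g x\<bar> \<le> M * K"
      unfolding abs_mult by (intro mult_mono f g M) auto
    also have "\<dots> \<le> 2 * M * K"
      using mult_nonneg_nonneg[OF M K] by linarith
    finally show ?thesis .
  qed
  show "\<bar>f x * g x - f y * g y\<bar> \<le> 2 * M * K * \<bar>x - y\<bar> powr \<alpha>" for x y
  proof -
    let ?d = "\<bar>x - y\<bar> powr \<alpha>"
    have "f x * g x - f y * g y = f x * (g x - g y) + (f x - f y) * g y"
      by (simp add: algebra_simps)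
    then have "\<bar>f x * g x - f y * g y\<bar> \<le> \<bar>f x\<bar> * \<bar>g x - g y\<bar> + \<bar>f x - f y\<bar> * \<bar>g y\<bar>"
      by (metis abs_mult abs_triangle_ineq)
    also have "\<dots> \<le> M * (K * ?d) + (M * ?d) * K"
      by (intro add_mono mult_mono f g M mult_nonneg_nonneg) auto
    finally show ?thesis by (simp add: algebra_simps)
  qed
qed

lemma holder_bounded_scale:
  assumes "holder_bounded \<alpha> M f"
  shows "holder_bounded \<alpha> (\<bar>c\<bar> * M) (\<lambda>x. c * f x)"
proof (rule holder_boundedI)
  show "\<bar>c * f x\<bar> \<le> \<bar>c\<bar> * M" for x
    unfolding abs_mult by (intro mult_left_mono holder_boundedD(1)[OF assms]) auto
  show "\<bar>c * f x - c * f y\<bar> \<le> \<bar>c\<bar> * M * \<bar>x - y\<bar> powr \<alpha>" for x y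
    unfolding right_diff_distrib[symmetric] abs_mult mult.assoc
    by (intro mult_left_mono holder_boundedD(2)[OF assms]) auto
qed

lemma holder_bounded_diff:
  assumes "holder_bounded \<alpha> M f" "holder_bounded \<alpha> K g"
  shows "holder_bounded \<alpha> (M + K) (\<lambda>x. f x - g x)"
  using holder_bounded_add[OF assms(1) holder_bounded_scale[OF assms(2), of "-1"]] by simp

lemma holder_bounded_inverse:
  assumes f: "holder_bounded \<alpha> M f" and m: "0 < m" "\<And>x. m \<le> f x"
  shows "\<exists>K. holder_bounded \<alpha> K (\<lambda>x. inverse (f x))"
proof
  define K where "K = max (1 / m) (M / (m * m))"
  have pos: "0 < f x" for x
    using m(1) m(2)[of x] by linarith
  show "holder_bounded \<alpha> K (\<lambda>x. inverse (f x))"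
  proof (rule holder_boundedI)
    show "\<bar>inverse (f x)\<bar> \<le> K" for x
      using le_imp_inverse_le[OF m(2) m(1), of x] pos[of x]
      by (simp add: K_def le_max_iff_disj inverse_eq_divide)
    show "\<bar>inverse (f x) - inverse (f y)\<bar> \<le> K * \<bar>x - y\<bar> powr \<alpha>" for x y
    proof -
      have "inverse (f x) - inverse (f y) = (f y - f x) / (f x * f y)"
        using pos[of x] pos[of y] by (simp add: divide_simps)
      then have "\<bar>inverse (f x) - inverse (f y)\<bar> = \<bar>f x - f y\<bar> / (f x * f y)"
        using pos[of x] pos[of y] by (simp add: abs_mult abs_minus_commute)
      also have "\<dots> \<le> (M * \<bar>x - y\<bar> powr \<alpha>) / (m * m)"
        using holder_boundedD(2)[OF f, of x y] m
        by (intro frac_le mult_mono mult_nonneg_nonneg holder_bounded_nonneg[OF f])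
           (auto intro: less_imp_le pos)
      also have "\<dots> \<le> K * \<bar>x - y\<bar> powr \<alpha>"
        using mult_right_mono[of "M / (m * m)" K "\<bar>x - y\<bar> powr \<alpha>"] by (simp add: K_def)
      finally show ?thesis .
    qed
  qed
qed

text \<open>The maximum with \<open>1\<close> is there because the supremum part of the bound does not shrink when \<open>L\<close> is
  small.\<close>

lemma holder_bounded_compose_lipschitz:
  assumes f: "holder_bounded \<alpha> M f" and "0 \<le> \<alpha>"
    and h: "\<And>x y. \<bar>h x - h y\<bar> \<le> L * \<bar>x - y\<bar>"
  shows "holder_bounded \<alpha> (M * max 1 (L powr \<alpha>)) (\<lambda>x. f (h x))"
proof (rule holder_boundedI)
  note M = holder_bounded_nonneg[OF f]
  have L: "0 \<le> L"
    using h[of 0 1] by (simp add: order_trans[OF abs_ge_zero])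
  show "\<bar>f (h x)\<bar> \<le> M * max 1 (L powr \<alpha>)" for x
    using holder_boundedD(1)[OF f, of "h x"] mult_left_mono[OF max.cobounded1 M, of 1 "L powr \<alpha>"]
    by simp
  show "\<bar>f (h x) - f (h y)\<bar> \<le> M * max 1 (L powr \<alpha>) * \<bar>x - y\<bar> powr \<alpha>" for x y
  proof -
    have "\<bar>h x - h y\<bar> powr \<alpha> \<le> (L * \<bar>x - y\<bar>) powr \<alpha>"
      using h \<open>0 \<le> \<alpha>\<close> by (intro powr_mono2) auto
    also have "\<dots> = L powr \<alpha> * \<bar>x - y\<bar> powr \<alpha>"
      using L by (simp add: powr_mult)
    also have "\<dots> \<le> max 1 (L powr \<alpha>) * \<bar>x - y\<bar> powr \<alpha>"
      by (intro mult_right_mono) auto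
    finally have "M * \<bar>h x - h y\<bar> powr \<alpha> \<le> M * (max 1 (L powr \<alpha>) * \<bar>x - y\<bar> powr \<alpha>)"
      by (intro mult_left_mono M)
    with holder_boundedD(2)[OF f, of "h x" "h y"] show ?thesis
      by (simp add: mult.assoc)
  qed
qed

lemma continuous_on_holder:
  fixes f :: "real \<Rightarrow> real"
  assumes "0 < \<alpha>" and f: "\<And>x y. \<bar>f x - f y\<bar> \<le> c * \<bar>x - y\<bar> powr \<alpha>"
  shows "continuous_on UNIV f"
proof -
  have "isCont f x" for x
  proof -
    have "((\<lambda>y. c * \<bar>y - x\<bar> powr \<alpha>) \<longlongrightarrow> c * \<bar>x - x\<bar> powr \<alpha>) (at x)"
      using \<open>0 < \<alpha>\<close> by (intro tendsto_intros tendsto_powr') auto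
    then have lim: "((\<lambda>y. c * \<bar>y - x\<bar> powr \<alpha>) \<longlongrightarrow> 0) (at x)"
      by simp
    have "\<forall>\<^sub>F y in at x. norm (f y - f x) \<le> c * \<bar>y - x\<bar> powr \<alpha>"
      using f by (intro always_eventually) simp
    then have "((\<lambda>y. f y - f x) \<longlongrightarrow> 0) (at x)"
      by (rule Lim_null_comparison[OF _ lim])
    then show ?thesis
      by (simp add: isCont_def LIM_zero_iff)
  qed
  then show ?thesis
    by (simp add: continuous_at_imp_continuous_on)
qed

section \<open>Equivariant lifts with Hoelder derivative\<close>

lemma two_pi_pos: "0 < 2 * pi"
  by simp

lemma cis_eq_cis_iff: "cis x = cis y \<longleftrightarrow> (\<exists>n::int. x = y + 2 * pi * of_int n)"
  using sin_cos_eq_iff[of x y] by (auto simp: complex_eq_iff)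

lemma periodic_value_in_period:
  fixes f :: "real \<Rightarrow> 'a"
  assumes "\<And>x. f (x + 2 * pi) = f x"
  obtains y where "y \<in> {0..2*pi}" "f x = f y"
proof -
  interpret periodic_fun_simple f "2 * pi"
    by standard (rule assms)
  define n where "n = \<lfloor>x / (2 * pi)\<rfloor>"
  have "of_int n \<le> x / (2 * pi)" "x / (2 * pi) \<le> of_int n + 1"
    by (simp_all add: n_def less_imp_le)
  then have "x - of_int n * (2 * pi) \<in> {0..2*pi}"
    by (simp add: field_simps)
  moreover have "f x = f (x - of_int n * (2 * pi))"
    by (simp add: minus_of_int)
  ultimately show thesis using that by blast
qed

text \<open>These are the lifts of the elements of \<open>Diff_Holder \<alpha>\<close>, by \<open>circle_map_in_Diff_Holder\<close> and
  \<open>Diff_Holder_lift\<close>. The lower bound on the derivative is required to be uniform, so that the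
  condition passes to inverses and to convex combinations by direct estimates.\<close>

definition holder_lift :: "real \<Rightarrow> (real \<Rightarrow> real) \<Rightarrow> bool" where
  "holder_lift \<alpha> g \<longleftrightarrow>
     (\<forall>x. (g has_real_derivative deriv g x) (at x)) \<and>
     (\<exists>m>0. \<forall>x. m \<le> deriv g x) \<and>
     (\<exists>M. holder_bounded \<alpha> M (deriv g)) \<and>
     (\<forall>x. g (x + 2 * pi) = g x + 2 * pi)"

lemma holder_liftI:
  assumes "\<And>x. (g has_real_derivative g' x) (at x)" "0 < m" "\<And>x. m \<le> g' x"
    "holder_bounded \<alpha> M g'" "\<And>x. g (x + 2 * pi) = g x + 2 * pi"
  shows "holder_lift \<alpha> g"
proof -
  have "deriv g = g'"
    using assms(1) DERIV_imp_deriv by blast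
  then show ?thesis
    using assms by (auto simp: holder_lift_def)
qed

lemma holder_lift_id: "holder_lift \<alpha> (\<lambda>x. x)"
  by (rule holder_liftI[where g' = "\<lambda>x. 1" and m = 1, OF _ _ _ holder_bounded_const]) auto

lemma holder_lift_has_derivative:
  "holder_lift \<alpha> g \<Longrightarrow> (g has_real_derivative deriv g x) (at x)"
  by (simp add: holder_lift_def)

lemma holder_lift_period: "holder_lift \<alpha> g \<Longrightarrow> g (x + 2 * pi) = g x + 2 * pi"
  by (simp add: holder_lift_def)

lemma holder_lift_deriv_lower:
  assumes "holder_lift \<alpha> g"
  obtains m where "0 < m" "\<And>x. m \<le> deriv g x"
  using assms unfolding holder_lift_def by blast

lemma holder_lift_deriv_pos:
  assumes "holder_lift \<alpha> g"
  shows "0 < deriv g x"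
  using assms by (rule holder_lift_deriv_lower) (rule less_le_trans)

lemma holder_lift_deriv_holder:
  assumes "holder_lift \<alpha> g"
  obtains M where "holder_bounded \<alpha> M (deriv g)"
  using assms unfolding holder_lift_def by blast

text \<open>The displacement \<open>g x - x\<close> is periodic.\<close>

lemma holder_lift_shift_int:
  assumes "holder_lift \<alpha> g"
  shows "g (x + 2 * pi * of_int k) = g x + 2 * pi * of_int k"
proof -
  interpret periodic_fun_simple "\<lambda>x. g x - x" "2 * pi"
    by unfold_locales (simp add: holder_lift_period[OF assms])
  show ?thesis
    using plus_of_int[of x k] by (simp add: mult.commute)
qed

lemma holder_lift_continuous:
  assumes "holder_lift \<alpha> g"
  shows "continuous_on UNIV g"
  using holder_lift_has_derivative[OF assms]
  by (intro continuous_at_imp_continuous_on ballI) (rule DERIV_isCont)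

lemma holder_lift_deriv_continuous:
  assumes "holder_lift \<alpha> g" "0 < \<alpha>"
  shows "continuous_on UNIV (deriv g)"
proof -
  obtain M where "holder_bounded \<alpha> M (deriv g)"
    using assms(1) by (rule holder_lift_deriv_holder)
  from continuous_on_holder[OF assms(2) holder_boundedD(2)[OF this]] show ?thesis .
qed

lemma holder_lift_strict_mono:
  assumes "holder_lift \<alpha> g"
  shows "strict_mono g"
proof (rule strict_monoI)
  fix x y :: real assume "x < y"
  then show "g x < g y"
    by (rule DERIV_pos_imp_increasing)
       (use holder_lift_has_derivative[OF assms] holder_lift_deriv_pos[OF assms] in blast)
qed

lemma holder_lift_lipschitz:
  assumes "holder_lift \<alpha> g"
  shows "\<exists>L. \<forall>x y. \<bar>g x - g y\<bar> \<le> L * \<bar>x - y\<bar>"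
proof -
  obtain M where "holder_bounded \<alpha> M (deriv g)"
    using assms by (rule holder_lift_deriv_holder)
  then have "\<bar>g x - g y\<bar> \<le> M * \<bar>x - y\<bar>" for x y
    using field_differentiable_bound[OF convex_UNIV, of g "deriv g" M x y]
      holder_lift_has_derivative[OF assms] by (simp add: holder_boundedD(1))
  then show ?thesis by blast
qed

lemma holder_lift_bij:
  assumes g: "holder_lift \<alpha> g"
  shows "bij g"
proof (rule bijI)
  show "inj g"
    using holder_lift_strict_mono[OF g] by (rule strict_mono_imp_inj_on)
  show "surj g"
    unfolding surj_def
  proof
    fix y
    define n where "n = \<lfloor>(y - g 0) / (2 * pi)\<rfloor>"
    have "of_int n \<le> (y - g 0) / (2 * pi)" "(y - g 0) / (2 * pi) \<le> of_int n + 1"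
      by (simp_all add: n_def less_imp_le)
    then have "g (0 + 2 * pi * of_int n) \<le> y" "y \<le> g (0 + 2 * pi * of_int (n + 1))"
      unfolding holder_lift_shift_int[OF g] by (simp_all add: field_simps)
    moreover have "continuous_on {0 + 2 * pi * of_int n..0 + 2 * pi * of_int (n + 1)} g"
      using holder_lift_continuous[OF g] continuous_on_subset by blast
    ultimately show "\<exists>x. y = g x"
      using IVT'[of g "0 + 2 * pi * of_int n" y "0 + 2 * pi * of_int (n + 1)"]
      by (auto simp: algebra_simps)
  qed
qed

lemma holder_lift_inv_derivative:
  assumes g: "holder_lift \<alpha> g"
  shows "(inv g has_real_derivative inverse (deriv g (inv g x))) (at x)"
proof -
  have gi: "g (inv g y) = y" "inv g (g y) = y" for y
    using holder_lift_bij[OF g] by (simp_all add: bij_is_surj surj_f_inv_f bij_is_inj)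
  have "isCont (inv g) (g (inv g x))"
    by (rule isCont_inverse_function[of 1])
       (use gi holder_lift_continuous[OF g] in \<open>auto simp: continuous_on_eq_continuous_at\<close>)
  then show ?thesis
    using holder_lift_deriv_pos[OF g, of "inv g x"]
    by (intro DERIV_inverse_function[of g _ "inv g" x "x - 1" "x + 1"])
       (auto simp: gi holder_lift_has_derivative[OF g])
qed

lemma holder_lift_inv:
  assumes g: "holder_lift \<alpha> g" and "0 \<le> \<alpha>"
  shows "holder_lift \<alpha> (inv g)"
proof -
  have gi: "g (inv g y) = y" "inv g (g y) = y" for y
    using holder_lift_bij[OF g] by (simp_all add: bij_is_surj surj_f_inv_f bij_is_inj)
  obtain m where m: "0 < m" "\<And>x. m \<le> deriv g x"
    using g by (rule holder_lift_deriv_lower) blast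
  obtain M where M: "holder_bounded \<alpha> M (deriv g)"
    using g by (rule holder_lift_deriv_holder)
  note pos = holder_lift_deriv_pos[OF g]
  have M_pos: "0 < M"
    using holder_boundedD(1)[OF M, of 0] pos[of 0] by linarith
  obtain K where K: "holder_bounded \<alpha> K (\<lambda>x. inverse (deriv g x))"
    using holder_bounded_inverse[OF M m] by blast
  have lip: "\<bar>inv g x - inv g y\<bar> \<le> K * \<bar>x - y\<bar>" for x y
    using field_differentiable_bound[OF convex_UNIV, of "inv g" "\<lambda>x. inverse (deriv g (inv g x))" K x y]
      holder_lift_inv_derivative[OF g] holder_boundedD(1)[OF K] by simp
  show ?thesis
  proof (rule holder_liftI[OF holder_lift_inv_derivative[OF g], where m = "inverse M"])
    show "inverse M \<le> inverse (deriv g (inv g x))" for x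
      using holder_boundedD(1)[OF M, of "inv g x"] pos by (intro le_imp_inverse_le) auto
    show "holder_bounded \<alpha> (K * max 1 (K powr \<alpha>)) (\<lambda>x. inverse (deriv g (inv g x)))"
      by (rule holder_bounded_compose_lipschitz[OF K \<open>0 \<le> \<alpha>\<close> lip])
    show "inv g (x + 2 * pi) = inv g x + 2 * pi" for x
    proof -
      have "g (inv g x + 2 * pi) = x + 2 * pi"
        by (simp add: holder_lift_period[OF g] gi)
      then show ?thesis
        by (metis gi(2))
    qed
  qed (use M_pos in simp)
qed

lemma holder_lift_C1:
  assumes "holder_lift \<alpha> g" "0 < \<alpha>"
  shows "g C1_differentiable_on UNIV"
  using holder_lift_deriv_continuous[OF assms] holder_lift_has_derivative[OF assms(1)]
  unfolding C1_differentiable_on_def has_real_derivative_iff_has_vector_derivative[symmetric]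
  by blast

lemma circle_cisE:
  assumes "z \<in> circle"
  obtains x where "z = cis x"
proof -
  have "z \<noteq> 0" using assms by auto
  then have "cis (Arg z) = z"
    using assms by (simp add: cis_Arg sgn_eq)
  then show thesis
    using that by metis
qed

section \<open>The circle map of a lift\<close>

definition circle_map :: "(real \<Rightarrow> real) \<Rightarrow> complex \<Rightarrow> complex" where
  "circle_map g = (\<lambda>z\<in>circle. cis (g (Arg z)))"

text \<open>\<open>Arg (cis x)\<close> differs from \<open>x\<close> by a multiple of \<open>2 * pi\<close>, and by equivariance \<open>g\<close> carries this
  multiple over unchanged.\<close>

lemma circle_map_cis:
  assumes g: "holder_lift \<alpha> g"
  shows "circle_map g (cis x) = cis (g x)"
proof -
  have "cis x = cis (Arg (cis x))"
    by (subst cis_Arg) (auto simp: sgn_eq)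
  then obtain n :: int where "x = Arg (cis x) + 2 * pi * of_int n"
    using cis_eq_cis_iff by blast
  then have "g x = g (Arg (cis x)) + 2 * pi * of_int n"
    using holder_lift_shift_int[OF g] by metis
  then have "cis (g x) = cis (g (Arg (cis x)))"
    using cis_eq_cis_iff by blast
  then show ?thesis
    by (simp add: circle_map_def)
qed

lemma is_lift_circle_map: "holder_lift \<alpha> g \<Longrightarrow> is_lift (circle_map g) g"
  by (simp add: is_lift_def holder_lift_continuous circle_map_cis)

lemma circle_map_in_Diff_Holder:
  assumes g: "holder_lift \<alpha> g" and "0 < \<alpha>"
  shows "circle_map g \<in> Diff_Holder \<alpha>"
proof -
  have gi: "g (inv g y) = y" "inv g (g y) = y" for y
    using holder_lift_bij[OF g] by (simp_all add: bij_is_surj surj_f_inv_f bij_is_inj)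
  have h: "holder_lift \<alpha> (inv g)"
    using holder_lift_inv[OF g] \<open>0 < \<alpha>\<close> by simp
  have bij: "bij_betw (circle_map g) circle circle"
    by (rule bij_betw_byWitness[where f' = "circle_map (inv g)"])
       (auto elim!: circle_cisE simp: circle_map_cis[OF g] circle_map_cis[OF h] gi)
  have "inv_into circle (circle_map g) (cis x) = cis (inv g x)" for x
    using bij by (intro inv_into_f_eq) (auto simp: circle_map_cis[OF g] gi bij_betw_def)
  then have "is_lift (inv_into circle (circle_map g)) (inv g)"
    by (simp add: is_lift_def holder_lift_continuous[OF h])
  then have "circle_diffeo (circle_map g)"
    using bij is_lift_circle_map[OF g] holder_lift_C1[OF g \<open>0 < \<alpha>\<close>] holder_lift_C1[OF h \<open>0 < \<alpha>\<close>]
    by (auto simp: circle_diffeo_def circle_C1_def)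
  moreover obtain M where M: "holder_bounded \<alpha> M (deriv g)"
    using g by (rule holder_lift_deriv_holder)
  have "\<exists>f c. is_lift (circle_map g) f \<and> c \<ge> 0 \<and>
        (\<forall>x y. \<bar>deriv f x - deriv f y\<bar> \<le> c * \<bar>x - y\<bar> powr \<alpha>)"
    using is_lift_circle_map[OF g] holder_boundedD(2)[OF M] holder_bounded_nonneg[OF M]
    by blast
  moreover have "circle_map g \<in> extensional circle"
    by (simp add: circle_map_def)
  moreover have "orientation_preserving (circle_map g)"
    using is_lift_circle_map[OF g] holder_lift_strict_mono[OF g]
    by (auto simp: orientation_preserving_def)
  ultimately show ?thesis
    by (simp add: Diff_Holder_def)
qed

section \<open>Lifts of elements of the diffeomorphism group\<close>

text \<open>A lift shifts by \<open>2 * pi * k\<close> over a period, with \<open>k > 0\<close> by monotonicity. If \<open>k\<close> were at least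
  \<open>2\<close>, the lift would gain \<open>2 * pi\<close> strictly inside one period, and the circle map would take the
  same value at two different points.\<close>

lemma lift_degree_one:
  assumes g: "is_lift \<phi> g" "strict_mono g" and inj: "inj_on \<phi> circle"
  shows "g (x + 2 * pi) = g x + 2 * pi"
proof -
  have cont: "continuous_on UNIV g" and lift: "\<And>x. cis (g x) = \<phi> (cis x)"
    using g by (auto simp: is_lift_def)
  have "is_lift \<phi> (\<lambda>x. g (x + 2 * pi))"
  proof -
    have "continuous_on UNIV (\<lambda>x. g (x + 2 * pi))"
      by (intro continuous_on_compose2[OF cont] continuous_intros) auto
    moreover have "cis (x + 2 * pi) = cis x" for x
      by (metis cis_eq_cis_iff mult.right_neutral of_int_1)
    ultimately show ?thesis
      by (simp add: is_lift_def lift)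
  qed
  then obtain k :: int where k: "\<And>x. g (x + 2 * pi) = g x + 2 * pi * of_int k"
    using is_lift_unique g(1) by blast
  have "g 0 < g (0 + 2 * pi)"
    by (rule strict_monoD[OF g(2)]) simp
  then have "0 < k"
    unfolding k by (simp add: zero_less_mult_iff)
  moreover have "\<not> 2 \<le> k"
  proof
    assume "2 \<le> k"
    then have "2 * pi * 2 \<le> 2 * pi * of_int k"
      by (intro mult_left_mono) auto
    then have less: "g 0 + 2 * pi < g (0 + 2 * pi)"
      unfolding k using pi_gt_zero by linarith
    have "continuous_on {0..2*pi} g"
      using cont continuous_on_subset by blast
    then obtain y where y: "0 \<le> y" "y \<le> 2 * pi" "g y = g 0 + 2 * pi"
      using IVT'[of g 0 "g 0 + 2 * pi" "2 * pi"] less by auto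
    have ne: "y \<noteq> 0" "y \<noteq> 2 * pi"
      using y(3) less by auto
    have "\<phi> (cis y) = \<phi> (cis 0)"
      using y(3) unfolding lift[symmetric] by (metis cis_eq_cis_iff mult.right_neutral of_int_1)
    then have "cis y = cis 0"
      using inj by (auto dest!: inj_onD)
    then obtain n :: int where "y = 2 * pi * of_int n"
      unfolding cis_eq_cis_iff by auto
    with y ne have "2 * pi * 0 < 2 * pi * of_int n" "2 * pi * of_int n < 2 * pi * 1"
      by linarith+
    then have "0 < n" "n < 1"
      unfolding mult_less_cancel_left_pos[OF two_pi_pos] by linarith+
    then show False by simp
  qed
  ultimately have "k = 1" by simp
  then show ?thesis using k by simp
qed

text \<open>The inverse has a differentiable lift \<open>h\<close> too, and \<open>h \<circ> g\<close> lifts the identity, so it is a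
  translation; the chain rule then writes \<open>1\<close> as a multiple of \<open>D\<close>.\<close>

lemma C1_lift_deriv_nonzero:
  assumes diffeo: "circle_diffeo \<phi>" and g: "is_lift \<phi> g" "(g has_real_derivative D) (at x)"
  shows "D \<noteq> 0"
proof -
  obtain h where h: "is_lift (inv_into circle \<phi>) h" "h C1_differentiable_on UNIV"
    using diffeo by (auto simp: circle_diffeo_def circle_C1_def)
  have "cis (h (g x)) = cis x" for x
    using diffeo g(1) h(1) by (simp add: is_lift_def circle_diffeo_def bij_betw_def inv_into_f_f)
  moreover have "continuous_on UNIV (\<lambda>x. h (g x))"
    using g(1) h(1) by (auto simp: is_lift_def intro: continuous_on_compose2)
  ultimately have "is_lift (\<lambda>z. z) (\<lambda>x. h (g x))" "is_lift (\<lambda>z. z) (\<lambda>x. x)"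
    by (auto simp: is_lift_def)
  then obtain k :: int where k: "\<And>x. h (g x) = x + 2 * pi * of_int k"
    using is_lift_unique by blast
  obtain E where "(h has_real_derivative E) (at (g x))"
    using h(2) by (auto simp: C1_differentiable_on_def has_real_derivative_iff_has_vector_derivative)
  then have "((\<lambda>x. h (g x)) has_real_derivative E * D) (at x)"
    using g(2) by (rule DERIV_chain2)
  then have "((\<lambda>x. x + 2 * pi * of_int k) has_real_derivative E * D) (at x)"
    by (simp add: k)
  moreover have "((\<lambda>x. x + 2 * pi * of_int k) has_real_derivative 1) (at x)"
    by (auto intro!: derivative_eq_intros)
  ultimately have "E * D = 1"
    by (rule DERIV_unique)
  then show ?thesis by auto
qed

text \<open>Membership in \<open>Diff_Holder \<alpha>\<close> supplies separate lifts for smoothness, monotonicity and the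
  Hoelder condition. They differ by constants, so one lift has all three properties. The
  derivative is positive, continuous and periodic, hence bounded and bounded away from \<open>0\<close> by
  compactness of a period.\<close>

lemma Diff_Holder_lift:
  assumes \<phi>: "\<phi> \<in> Diff_Holder \<alpha>" and g: "is_lift \<phi> g" and "0 < \<alpha>"
  shows "holder_lift \<alpha> g"
proof -
  have diffeo: "circle_diffeo \<phi>"
    using \<phi> by (simp add: Diff_Holder_def)
  obtain g0 where g0: "is_lift \<phi> g0" "g0 C1_differentiable_on UNIV"
    using diffeo by (auto simp: circle_diffeo_def circle_C1_def)
  obtain k where k: "\<And>x. g x = g0 x + 2 * pi * of_int k"
    using is_lift_unique[OF g g0(1)] by blast
  have der: "(g has_real_derivative deriv g x) (at x)" for x
  proof -
    obtain D where "(g0 has_real_derivative D) (at x)"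
      using g0(2) by (auto simp: C1_differentiable_on_def has_real_derivative_iff_has_vector_derivative)
    then have "(g has_real_derivative D) (at x)"
      unfolding k[abs_def] by (auto intro!: derivative_eq_intros)
    then show ?thesis
      using DERIV_imp_deriv by blast
  qed
  obtain g1 where g1: "is_lift \<phi> g1" "strict_mono g1"
    using \<phi> by (auto simp: Diff_Holder_def orientation_preserving_def)
  obtain k1 where k1: "\<And>x. g x = g1 x + 2 * pi * of_int k1"
    using is_lift_unique[OF g g1(1)] by blast
  have mono: "strict_mono g"
    using g1(2) by (auto simp: strict_mono_def k1)
  have deg: "g (x + 2 * pi) = g x + 2 * pi" for x
    using lift_degree_one[OF g mono] diffeo by (simp add: circle_diffeo_def bij_betw_def)
  have pos: "0 < deriv g x" for x
  proof -
    have "0 \<le> deriv g x"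
      using mono der
      by (intro mono_on_imp_deriv_nonneg[of UNIV g]) (auto simp: strict_mono_mono)
    with C1_lift_deriv_nonzero[OF diffeo g der] show ?thesis
      by (simp add: order_less_le)
  qed
  obtain g2 c where g2: "is_lift \<phi> g2" "0 \<le> c"
      "\<And>x y. \<bar>deriv g2 x - deriv g2 y\<bar> \<le> c * \<bar>x - y\<bar> powr \<alpha>"
    using \<phi> by (auto simp: Diff_Holder_def)
  have c: "\<bar>deriv g x - deriv g y\<bar> \<le> c * \<bar>x - y\<bar> powr \<alpha>" for x y
    using g2 deriv_the_lift[OF g] deriv_the_lift[OF g2(1)] by simp
  have cont: "continuous_on {0..2*pi} (deriv g)"
    using continuous_on_holder[OF \<open>0 < \<alpha>\<close> c] continuous_on_subset by blast
  have per: "deriv g (x + 2 * pi) = deriv g x" for x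
  proof -
    have "((\<lambda>x. g (x + 2 * pi)) has_real_derivative deriv g (x + 2 * pi)) (at x)"
      using der[of "x + 2 * pi"] DERIV_shift by blast
    then have "((\<lambda>x. g x + 2 * pi) has_real_derivative deriv g (x + 2 * pi)) (at x)"
      by (simp add: deg)
    moreover have "((\<lambda>x. g x + 2 * pi) has_real_derivative deriv g x) (at x)"
      using der[of x] by (auto intro!: derivative_eq_intros)
    ultimately show ?thesis
      by (rule DERIV_unique)
  qed
  obtain a where a: "\<And>y. y \<in> {0..2*pi} \<Longrightarrow> deriv g a \<le> deriv g y"
    using continuous_attains_inf[OF _ _ cont] pi_ge_zero by fastforce
  obtain b where b: "\<And>y. y \<in> {0..2*pi} \<Longrightarrow> deriv g y \<le> deriv g b"
    using continuous_attains_sup[OF _ _ cont] pi_ge_zero by fastforce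
  have lower: "deriv g a \<le> deriv g x" and upper: "deriv g x \<le> deriv g b" for x
    using periodic_value_in_period[of "deriv g" x, OF per] a b by metis+
  have "holder_bounded \<alpha> (max c (deriv g b)) (deriv g)"
  proof (rule holder_boundedI)
    show "\<bar>deriv g x\<bar> \<le> max c (deriv g b)" for x
      using pos[of x] upper[of x] by simp
    show "\<bar>deriv g x - deriv g y\<bar> \<le> max c (deriv g b) * \<bar>x - y\<bar> powr \<alpha>" for x y
      using c[of x y] mult_right_mono[of c "max c (deriv g b)" "\<bar>x - y\<bar> powr \<alpha>"] by simp
  qed
  then show ?thesis
    using der deg pos lower by (auto simp: holder_lift_def)
qed


lemma is_lift_the_lift: "\<phi> \<in> Diff_Holder \<alpha> \<Longrightarrow> is_lift \<phi> (the_lift \<phi>)"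
  unfolding Diff_Holder_def the_lift_def by (auto intro: someI[of "is_lift \<phi>"])

lemma holder_lift_the_lift:
  "\<phi> \<in> Diff_Holder \<alpha> \<Longrightarrow> 0 < \<alpha> \<Longrightarrow> holder_lift \<alpha> (the_lift \<phi>)"
  using Diff_Holder_lift is_lift_the_lift by blast

section \<open>Comparing the right uniform structure with the Hoelder norm\<close>

text \<open>Here \<open>u\<close> stands for the derivative of a lift \<open>g\<close>, and \<open>u (inv f x) / deriv f (inv f x)\<close> is
  then the derivative of \<open>g \<circ> inv f\<close> (see \<open>deriv_quotient\<close>). The relative deviation is
  \<open>(u - f') * (1 / f')\<close> composed with \<open>inv f\<close>, a product with a bounded Hoelder function followed by
  a Lipschitz substitution. What matters is that \<open>C\<close> depends on \<open>f\<close> only.\<close>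

lemma holder_bounded_relative:
  assumes f: "holder_lift \<alpha> f" and "0 < \<alpha>"
  shows "\<exists>C\<ge>0. \<forall>u \<delta>. holder_bounded \<alpha> \<delta> (\<lambda>x. u x - deriv f x) \<longrightarrow>
           holder_bounded \<alpha> (C * \<delta>) (\<lambda>x. u (inv f x) / deriv f (inv f x) - 1)"
proof -
  obtain m where m: "0 < m" "\<And>x. m \<le> deriv f x"
    using f by (rule holder_lift_deriv_lower) blast
  obtain M where M: "holder_bounded \<alpha> M (deriv f)"
    using f by (rule holder_lift_deriv_holder)
  obtain K where K: "holder_bounded \<alpha> K (\<lambda>x. inverse (deriv f x))"
    using holder_bounded_inverse[OF M m] by blast
  have "holder_lift \<alpha> (inv f)"
    using f \<open>0 < \<alpha>\<close> by (intro holder_lift_inv) auto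
  then obtain L where L: "\<And>x y. \<bar>inv f x - inv f y\<bar> \<le> L * \<bar>x - y\<bar>"
    using holder_lift_lipschitz by blast
  define C where "C = 2 * K * max 1 (L powr \<alpha>)"
  have "holder_bounded \<alpha> (C * \<delta>) (\<lambda>x. u (inv f x) / deriv f (inv f x) - 1)"
    if "holder_bounded \<alpha> \<delta> (\<lambda>x. u x - deriv f x)" for u \<delta>
  proof -
    have "holder_bounded \<alpha> (2 * \<delta> * K * max 1 (L powr \<alpha>))
        (\<lambda>x. (u (inv f x) - deriv f (inv f x)) * inverse (deriv f (inv f x)))"
      by (rule holder_bounded_compose_lipschitz[OF holder_bounded_mult[OF that K] _ L])
         (use \<open>0 < \<alpha>\<close> in simp)
    moreover have "(u y - deriv f y) * inverse (deriv f y) = u y / deriv f y - 1" for y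
      using holder_lift_deriv_pos[OF f, of y] by (simp add: field_simps)
    ultimately show ?thesis
      by (simp add: C_def mult_ac)
  qed
  moreover have "0 \<le> C"
    using holder_bounded_nonneg[OF K] by (simp add: C_def)
  ultimately show ?thesis by blast
qed

text \<open>The converse estimate undoes the two operations: substitute \<open>f x\<close> for the argument, then multiply
  by \<open>f'\<close>.\<close>

lemma holder_bounded_absolute:
  assumes f: "holder_lift \<alpha> f" and "0 < \<alpha>"
  shows "\<exists>C\<ge>0. \<forall>u \<delta>. holder_bounded \<alpha> \<delta> (\<lambda>x. u (inv f x) / deriv f (inv f x) - 1) \<longrightarrow>
           holder_bounded \<alpha> (C * \<delta>) (\<lambda>x. u x - deriv f x)"
proof -
  obtain M where M: "holder_bounded \<alpha> M (deriv f)"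
    using f by (rule holder_lift_deriv_holder)
  obtain L where L: "\<And>x y. \<bar>f x - f y\<bar> \<le> L * \<bar>x - y\<bar>"
    using holder_lift_lipschitz[OF f] by blast
  define C where "C = 2 * M * max 1 (L powr \<alpha>)"
  have "holder_bounded \<alpha> (C * \<delta>) (\<lambda>x. u x - deriv f x)"
    if "holder_bounded \<alpha> \<delta> (\<lambda>x. u (inv f x) / deriv f (inv f x) - 1)" for u \<delta>
  proof -
    have "holder_bounded \<alpha> (\<delta> * max 1 (L powr \<alpha>))
        (\<lambda>x. u (inv f (f x)) / deriv f (inv f (f x)) - 1)"
      by (rule holder_bounded_compose_lipschitz[OF that _ L]) (use \<open>0 < \<alpha>\<close> in simp)
    then have "holder_bounded \<alpha> (\<delta> * max 1 (L powr \<alpha>)) (\<lambda>x. u x / deriv f x - 1)"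
      using holder_lift_bij[OF f] by (simp add: bij_is_inj)
    from holder_bounded_mult[OF this M]
    have "holder_bounded \<alpha> (2 * (\<delta> * max 1 (L powr \<alpha>)) * M) (\<lambda>x. (u x / deriv f x - 1) * deriv f x)" .
    moreover have "(u x / deriv f x - 1) * deriv f x = u x - deriv f x" for x
      using holder_lift_deriv_pos[OF f, of x] by (simp add: field_simps)
    ultimately show ?thesis
      by (simp add: C_def mult_ac)
  qed
  moreover have "0 \<le> C"
    using holder_bounded_nonneg[OF M] by (simp add: C_def)
  ultimately show ?thesis by blast
qed

lemma is_lift_quotient:
  assumes \<phi>: "\<phi> \<in> Diff_Holder \<alpha>" "is_lift \<phi> f" and \<psi>: "\<psi> \<in> Diff_Holder \<alpha>" "is_lift \<psi> g"
    and "0 < \<alpha>"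
  shows "is_lift (compose circle \<psi> (inv_into circle \<phi>)) (\<lambda>x. g (inv f x))"
proof -
  have f: "holder_lift \<alpha> f"
    using Diff_Holder_lift \<phi> \<open>0 < \<alpha>\<close> by blast
  have bij: "bij_betw \<phi> circle circle"
    using \<phi> by (simp add: Diff_Holder_def circle_diffeo_def)
  have "inv_into circle \<phi> (cis x) = cis (inv f x)" for x
  proof (rule inv_into_f_eq)
    show "inj_on \<phi> circle"
      using bij by (simp add: bij_betw_def)
    have "cis (f (inv f x)) = \<phi> (cis (inv f x))"
      using \<phi>(2) by (simp add: is_lift_def)
    then show "\<phi> (cis (inv f x)) = cis x"
      using holder_lift_bij[OF f] by (simp add: bij_is_surj surj_f_inv_f)
  qed simp
  moreover have "continuous_on UNIV (inv f)"
    using holder_lift_inv[OF f] \<open>0 < \<alpha>\<close> by (intro holder_lift_continuous) auto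
  then have "continuous_on UNIV (\<lambda>x. g (inv f x))"
    using \<psi>(2) by (auto simp: is_lift_def intro: continuous_on_compose2)
  ultimately show ?thesis
    using \<psi>(2) by (simp add: is_lift_def compose_def)
qed

lemma deriv_quotient:
  assumes f: "holder_lift \<alpha> f" and g: "holder_lift \<alpha> g"
  shows "deriv (\<lambda>x. g (inv f x)) x = deriv g (inv f x) / deriv f (inv f x)"
  using DERIV_chain2[OF holder_lift_has_derivative[OF g] holder_lift_inv_derivative[OF f]]
  by (intro DERIV_imp_deriv) (simp add: divide_inverse)

text \<open>Each of the three suprema in \<open>p_Holder\<close> contributes at most \<open>\<eta>\<close>.\<close>

lemma p_Holder_le:
  assumes q: "is_lift \<omega> q" and disp: "\<And>x. norm (cis (q x) - cis x) \<le> \<eta>"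
    and der: "holder_bounded \<alpha> \<eta> (\<lambda>x. deriv q x - 1)"
  shows "p_Holder \<alpha> \<omega> \<le> 3 * \<eta>"
proof -
  have 1: "(SUP \<zeta>\<in>circle. norm (\<omega> \<zeta> - \<zeta>)) \<le> \<eta>"
  proof (rule cSUP_least)
    fix \<zeta> :: complex assume "\<zeta> \<in> circle"
    then obtain x where "\<zeta> = cis x"
      by (rule circle_cisE)
    then show "norm (\<omega> \<zeta> - \<zeta>) \<le> \<eta>"
      using q disp[of x] by (simp add: is_lift_def)
  qed simp
  have 2: "(SUP x. \<bar>deriv q x - 1\<bar>) \<le> \<eta>"
    using holder_boundedD(1)[OF der] by (intro cSUP_least) auto
  have "\<bar>deriv q x - deriv q y\<bar> / \<bar>x - y\<bar> powr \<alpha> \<le> \<eta>" if "x \<noteq> y" for x y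
    using holder_boundedD(2)[OF der, of x y] that by (simp add: divide_le_eq)
  moreover have "(0, 1) \<in> {(x, y). (x::real) \<noteq> y}" by simp
  ultimately have 3: "(SUP (x, y)\<in>{(x, y). x \<noteq> y}. \<bar>deriv q x - deriv q y\<bar> / \<bar>x - y\<bar> powr \<alpha>) \<le> \<eta>"
    by (intro cSUP_least) auto
  from 1 2 3 show ?thesis
    unfolding p_Holder_def deriv_the_lift[OF q] by linarith
qed

text \<open>A real supremum over an unbounded set carries no information, so \<open>p_Holder\<close> bounds its ingredients
  only if these are known to be bounded. The hypothesis with an arbitrary \<open>K\<close> ensures this; the
  conclusion replaces \<open>K\<close> by the value of \<open>p_Holder\<close>.\<close>

lemma holder_bounded_p_Holder:
  assumes q: "is_lift \<omega> q" and der: "holder_bounded \<alpha> K (\<lambda>x. deriv q x - 1)"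
  shows "holder_bounded \<alpha> (p_Holder \<alpha> \<omega>) (\<lambda>x. deriv q x - 1)"
proof -
  define A where "A = (SUP \<zeta>\<in>circle. norm (\<omega> \<zeta> - \<zeta>))"
  define B where "B = (SUP x. \<bar>deriv q x - 1\<bar>)"
  define C where "C = (SUP (x, y)\<in>{(x, y). x \<noteq> y}. \<bar>deriv q x - deriv q y\<bar> / \<bar>x - y\<bar> powr \<alpha>)"
  have p: "p_Holder \<alpha> \<omega> = A + B + C"
    unfolding p_Holder_def deriv_the_lift[OF q] A_def B_def C_def ..
  have "norm (\<omega> z - z) \<le> 2" if z: "z \<in> circle" for z
  proof -
    obtain x where "z = cis x"
      using z by (rule circle_cisE)
    then have "norm (\<omega> z) = 1" "norm z = 1"
      using q by (metis is_lift_def norm_cis)+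
    then show ?thesis
      using norm_triangle_ineq4[of "\<omega> z" z] by simp
  qed
  then have "norm (\<omega> 1 - 1) \<le> A"
    unfolding A_def by (intro cSUP_upper bdd_aboveI[of _ 2]) auto
  then have A: "0 \<le> A"
    by (rule order_trans[OF norm_ge_zero])
  have B: "\<bar>deriv q x - 1\<bar> \<le> B" for x
    unfolding B_def using holder_boundedD(1)[OF der]
    by (intro cSUP_upper bdd_aboveI[of _ K]) auto
  have "\<bar>deriv q x - deriv q y\<bar> / \<bar>x - y\<bar> powr \<alpha> \<le> K" if "x \<noteq> y" for x y
    using holder_boundedD(2)[OF der, of x y] that by (simp add: divide_le_eq)
  then have bdd: "bdd_above ((\<lambda>(x, y). \<bar>deriv q x - deriv q y\<bar> / \<bar>x - y\<bar> powr \<alpha>) ` {(x, y). x \<noteq> y})"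
    by (intro bdd_aboveI[of _ K]) auto
  have C: "\<bar>deriv q x - deriv q y\<bar> / \<bar>x - y\<bar> powr \<alpha> \<le> C" if "x \<noteq> y" for x y
    unfolding C_def using cSUP_upper[OF _ bdd, of "(x, y)"] that by simp
  have C_nonneg: "0 \<le> C"
    using C[of 0 1] by (rule order_trans[rotated]) auto
  show ?thesis
  proof (rule holder_boundedI)
    show "\<bar>deriv q x - 1\<bar> \<le> p_Holder \<alpha> \<omega>" for x
      using B[of x] A C_nonneg unfolding p by linarith
    have CP: "C \<le> p_Holder \<alpha> \<omega>"
      using B[of 0] A unfolding p by linarith
    show "\<bar>(deriv q x - 1) - (deriv q y - 1)\<bar> \<le> p_Holder \<alpha> \<omega> * \<bar>x - y\<bar> powr \<alpha>" for x y
    proof (cases "x = y")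
      case False
      then have "\<bar>deriv q x - deriv q y\<bar> / \<bar>x - y\<bar> powr \<alpha> \<le> p_Holder \<alpha> \<omega>"
        using C CP order_trans by blast
      then show ?thesis
        using False by (simp add: divide_le_eq)
    qed simp
  qed
qed

text \<open>The open ball of radius \<open>\<delta>\<close> around \<open>\<phi>\<close> for the maximum of the supremum norm and the Hoelder
  seminorm of the difference of derivatives of lifts. On \<open>Diff_Holder \<alpha>\<close> this is only a
  pseudometric, since rotations are not separated from the identity.\<close>

definition deriv_ball :: "real \<Rightarrow> (complex \<Rightarrow> complex) \<Rightarrow> real \<Rightarrow> (complex \<Rightarrow> complex) set" where
  "deriv_ball \<alpha> \<phi> \<delta> = {\<psi> \<in> Diff_Holder \<alpha>. \<exists>M<\<delta>.
     holder_bounded \<alpha> M (\<lambda>x. deriv (the_lift \<psi>) x - deriv (the_lift \<phi>) x)}"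

lemma center_in_deriv_ball: "\<phi> \<in> Diff_Holder \<alpha> \<Longrightarrow> 0 < \<delta> \<Longrightarrow> \<phi> \<in> deriv_ball \<alpha> \<phi> \<delta>"
  using holder_bounded_const[of \<alpha> 0] by (auto simp: deriv_ball_def)

text \<open>Around a point \<open>\<omega>\<close> at distance \<open>M < \<delta>\<close> from the centre there is room for a further
  distance \<open>\<delta> - M\<close>. Since \<open>p_Holder\<close> of \<open>\<psi> \<circ> \<omega>\<inverse>\<close> controls the distance from \<open>\<omega>\<close> to \<open>\<psi>\<close> up to a
  factor \<open>C\<close>, the triangle inequality applies.\<close>

lemma openin_deriv_ball:
  assumes "0 < \<alpha>"
  shows "openin (right_uniform_topology \<alpha>) (deriv_ball \<alpha> \<phi> \<delta>)"
  unfolding openin_right_uniform_topology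
proof (intro conjI ballI)
  show "deriv_ball \<alpha> \<phi> \<delta> \<subseteq> Diff_Holder \<alpha>"
    by (auto simp: deriv_ball_def)
  fix \<omega> assume "\<omega> \<in> deriv_ball \<alpha> \<phi> \<delta>"
  then obtain M where \<omega>: "\<omega> \<in> Diff_Holder \<alpha>" and "M < \<delta>"
    and M: "holder_bounded \<alpha> M (\<lambda>x. deriv (the_lift \<omega>) x - deriv (the_lift \<phi>) x)"
    by (auto simp: deriv_ball_def)
  let ?f = "the_lift \<omega>"
  have f: "holder_lift \<alpha> ?f"
    using \<omega> assms by (rule holder_lift_the_lift)
  obtain C where C: "0 \<le> C"
    "\<And>u \<delta>. holder_bounded \<alpha> \<delta> (\<lambda>x. u (inv ?f x) / deriv ?f (inv ?f x) - 1) \<Longrightarrow>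
       holder_bounded \<alpha> (C * \<delta>) (\<lambda>x. u x - deriv ?f x)"
    using holder_bounded_absolute[OF f assms] by blast
  \<comment> \<open>\<open>C'\<close> provides the a priori bound that makes the suprema in \<open>p_Holder\<close> meaningful.\<close>
  obtain C' where C':
    "\<And>u \<delta>. holder_bounded \<alpha> \<delta> (\<lambda>x. u x - deriv ?f x) \<Longrightarrow>
       holder_bounded \<alpha> (C' * \<delta>) (\<lambda>x. u (inv ?f x) / deriv ?f (inv ?f x) - 1)"
    using holder_bounded_relative[OF f assms] by blast
  \<comment> \<open>The summand \<open>1\<close> makes \<open>C * \<epsilon> < \<delta> - M\<close> strict and covers the case \<open>C = 0\<close>.\<close>
  define \<epsilon> where "\<epsilon> = (\<delta> - M) / (C + 1)"
  have "0 < \<epsilon>"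
    using C(1) \<open>M < \<delta>\<close> by (simp add: \<epsilon>_def)
  moreover have "\<psi> \<in> deriv_ball \<alpha> \<phi> \<delta>"
    if \<psi>: "\<psi> \<in> Diff_Holder \<alpha>" and p: "p_Holder \<alpha> (compose circle \<psi> (inv_into circle \<omega>)) < \<epsilon>" for \<psi>
  proof -
    let ?g = "the_lift \<psi>" and ?\<rho> = "compose circle \<psi> (inv_into circle \<omega>)"
    have g: "holder_lift \<alpha> ?g"
      using \<psi> assms by (rule holder_lift_the_lift)
    obtain K1 where "holder_bounded \<alpha> K1 (deriv ?g)"
      using g by (rule holder_lift_deriv_holder)
    moreover obtain K2 where "holder_bounded \<alpha> K2 (deriv ?f)"
      using f by (rule holder_lift_deriv_holder)
    ultimately have "holder_bounded \<alpha> (C' * (K1 + K2)) (\<lambda>x. deriv ?g (inv ?f x) / deriv ?f (inv ?f x) - 1)"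
      by (intro C' holder_bounded_diff)
    then have "holder_bounded \<alpha> (p_Holder \<alpha> ?\<rho>) (\<lambda>x. deriv ?g (inv ?f x) / deriv ?f (inv ?f x) - 1)"
      using holder_bounded_p_Holder[OF is_lift_quotient[OF \<omega> is_lift_the_lift[OF \<omega>] \<psi> is_lift_the_lift[OF \<psi>] assms]]
      unfolding deriv_quotient[OF f g] by blast
    then have "holder_bounded \<alpha> (C * p_Holder \<alpha> ?\<rho>) (\<lambda>x. deriv ?g x - deriv ?f x)"
      by (rule C(2))
    from holder_bounded_add[OF this M]
    have "holder_bounded \<alpha> (C * p_Holder \<alpha> ?\<rho> + M) (\<lambda>x. deriv ?g x - deriv (the_lift \<phi>) x)"
      by simp
    moreover have "C * p_Holder \<alpha> ?\<rho> \<le> C * \<epsilon>"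
      using p C(1) by (intro mult_left_mono) auto
    moreover have "C * \<epsilon> < \<delta> - M"
      using C(1) \<open>M < \<delta>\<close> by (simp add: \<epsilon>_def field_simps)
    ultimately show ?thesis
      using \<psi> by (auto simp: deriv_ball_def intro!: exI[of _ "C * p_Holder \<alpha> ?\<rho> + M"])
  qed
  ultimately show "\<exists>\<epsilon>>0. \<forall>\<psi>\<in>Diff_Holder \<alpha>.
      p_Holder \<alpha> (compose circle \<psi> (inv_into circle \<omega>)) < \<epsilon> \<longrightarrow> \<psi> \<in> deriv_ball \<alpha> \<phi> \<delta>"
    by blast
qed

section \<open>Normalised lifts\<close>

definition normalized_lift :: "(complex \<Rightarrow> complex) \<Rightarrow> real \<Rightarrow> real" where
  "normalized_lift \<phi> x = the_lift \<phi> x - the_lift \<phi> 0"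

lemma is_lift_normalized_lift:
  assumes \<phi>: "\<phi> \<in> Diff_Holder \<alpha>" and "\<phi> 1 = 1"
  shows "is_lift \<phi> (normalized_lift \<phi>)"
proof -
  have lift: "cis (the_lift \<phi> x) = \<phi> (cis x)" "continuous_on UNIV (the_lift \<phi>)" for x
    using is_lift_the_lift[OF \<phi>] by (auto simp: is_lift_def)
  have "cis (the_lift \<phi> 0) = 1"
    unfolding lift using assms(2) by simp
  then have "cis (normalized_lift \<phi> x) = \<phi> (cis x)" for x
    by (simp add: normalized_lift_def cis_divide[symmetric] lift)
  moreover have "continuous_on UNIV (normalized_lift \<phi>)"
    unfolding normalized_lift_def[abs_def] by (intro continuous_intros lift)
  ultimately show ?thesis
    by (simp add: is_lift_def)
qed

lemma normalized_lift_facts: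
  assumes "\<phi> \<in> Diff_Holder_normalized \<alpha>" "0 < \<alpha>"
  shows "\<phi> \<in> Diff_Holder \<alpha>" "is_lift \<phi> (normalized_lift \<phi>)" "holder_lift \<alpha> (normalized_lift \<phi>)"
    "deriv (the_lift \<phi>) = deriv (normalized_lift \<phi>)"
    "normalized_lift \<phi> 0 = 0"
proof -
  show \<phi>: "\<phi> \<in> Diff_Holder \<alpha>"
    using assms by (simp add: Diff_Holder_normalized_def)
  show lift: "is_lift \<phi> (normalized_lift \<phi>)"
    using assms by (intro is_lift_normalized_lift) (auto simp: Diff_Holder_normalized_def)
  show "holder_lift \<alpha> (normalized_lift \<phi>)"
    using \<phi> lift \<open>0 < \<alpha>\<close> by (rule Diff_Holder_lift)
  show "deriv (the_lift \<phi>) = deriv (normalized_lift \<phi>)"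
    using lift by (rule deriv_the_lift)
  show "normalized_lift \<phi> 0 = 0"
    by (simp add: normalized_lift_def)
qed

text \<open>A fixed point \<open>cis x\<close> determines the value of the lift at \<open>x\<close> up to a multiple of \<open>2 * pi\<close>; as the
  lift is increasing with values \<open>0\<close> and \<open>2 * pi\<close> at the ends of the period, the multiple is \<open>0\<close>.\<close>

lemma normalized_lift_fixed_point:
  assumes \<phi>: "\<phi> \<in> Diff_Holder_normalized \<alpha>" "0 < \<alpha>"
    and x: "0 < x" "x < 2 * pi" "\<phi> (cis x) = cis x"
  shows "normalized_lift \<phi> x = x"
proof -
  let ?f = "normalized_lift \<phi>"
  note f = normalized_lift_facts[OF \<phi>]
  have "cis (?f x) = cis x"
    using f(2) x(3) by (simp add: is_lift_def)
  then obtain n :: int where n: "?f x = x + 2 * pi * of_int n"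
    unfolding cis_eq_cis_iff by blast
  have "?f 0 < ?f x" "?f x < ?f (0 + 2 * pi)"
    using x by (auto intro!: strict_monoD[OF holder_lift_strict_mono[OF f(3)]])
  then have "0 < ?f x" "?f x < 2 * pi"
    unfolding holder_lift_period[OF f(3)] f(5) by auto
  then have "2 * pi * of_int n < 2 * pi * 1" "2 * pi * (-1) < 2 * pi * of_int n"
    using n x by linarith+
  then have "n = 0"
    unfolding mult_less_cancel_left_pos[OF two_pi_pos] by linarith
  then show ?thesis
    using n by simp
qed

lemma norm_cis_diff_le: "norm (cis a - cis b) \<le> \<bar>a - b\<bar>"
proof -
  have "cis a - cis b = cis b * (cis (a - b) - 1)"
    by (simp add: right_diff_distrib cis_mult)
  then have "norm (cis a - cis b) = norm (cis (a - b) - 1)"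
    by (simp add: norm_mult)
  also have "\<dots> = 2 * \<bar>sin ((a - b) / 2)\<bar>"
    using dist_exp_i_1[of "a - b"] by (simp add: cis_conv_exp)
  also have "\<dots> \<le> \<bar>a - b\<bar>"
    using abs_sin_x_le_abs_x[of "(a - b) / 2"] by simp
  finally show ?thesis .
qed

text \<open>The difference vanishes at \<open>0\<close> and is periodic, so the mean value inequality need only be applied
  over one period.\<close>

lemma normalized_lifts_close:
  assumes f: "holder_lift \<alpha> f" "f 0 = 0" and g: "holder_lift \<alpha> g" "g 0 = 0"
    and d: "holder_bounded \<alpha> \<delta> (\<lambda>x. deriv g x - deriv f x)"
  shows "\<bar>g x - f x\<bar> \<le> 2 * pi * \<delta>"
proof -
  define e where "e = (\<lambda>x. g x - f x)"
  have "e (x + 2 * pi) = e x" for x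
    by (simp add: e_def holder_lift_period[OF f(1)] holder_lift_period[OF g(1)])
  then obtain y where y: "y \<in> {0..2*pi}" "e x = e y"
    by (rule periodic_value_in_period)
  have "(e has_real_derivative deriv g z - deriv f z) (at z)" for z
    unfolding e_def by (intro DERIV_diff holder_lift_has_derivative[OF f(1)] holder_lift_has_derivative[OF g(1)])
  then have "norm (e y - e 0) \<le> \<delta> * norm (y - 0)"
    by (intro field_differentiable_bound[OF convex_UNIV, of e "\<lambda>z. deriv g z - deriv f z"])
       (use holder_boundedD(1)[OF d] in auto)
  also have "\<dots> \<le> \<delta> * (2 * pi)"
    using y(1) holder_bounded_nonneg[OF d] by (intro mult_left_mono) auto
  finally show ?thesis
    using y(2) f(2) g(2) by (simp add: e_def mult_ac)
qed

text \<open>The normalisation is essential here: closeness of derivatives implies uniform closeness only for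
  maps that agree at a point.\<close>

lemma deriv_ball_in_p_Holder_ball:
  assumes \<phi>: "\<phi> \<in> Diff_Holder_normalized \<alpha>" and "0 < \<alpha>" "0 < \<epsilon>"
  obtains \<delta> where "0 < \<delta>" "\<And>\<psi>. \<psi> \<in> Diff_Holder_normalized \<alpha> \<Longrightarrow> \<psi> \<in> deriv_ball \<alpha> \<phi> \<delta> \<Longrightarrow>
    p_Holder \<alpha> (compose circle \<psi> (inv_into circle \<phi>)) < \<epsilon>"
proof -
  let ?f = "normalized_lift \<phi>"
  note f = normalized_lift_facts[OF \<phi> \<open>0 < \<alpha>\<close>]
  obtain C where C: "0 \<le> C"
    "\<And>u \<delta>. holder_bounded \<alpha> \<delta> (\<lambda>x. u x - deriv ?f x) \<Longrightarrow>
       holder_bounded \<alpha> (C * \<delta>) (\<lambda>x. u (inv ?f x) / deriv ?f (inv ?f x) - 1)"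
    using holder_bounded_relative[OF f(3) \<open>0 < \<alpha>\<close>] by blast
  \<comment> \<open>\<open>C\<close> bounds the two derivative terms of \<open>p_Holder\<close>, and \<open>2 * pi\<close> the displacement; \<open>D\<close> serves both.\<close>
  define D where "D = C + 2 * pi"
  have D: "0 < D" "C \<le> D" "2 * pi \<le> D"
    using C(1) two_pi_pos unfolding D_def by linarith+
  have "p_Holder \<alpha> (compose circle \<psi> (inv_into circle \<phi>)) < \<epsilon>"
    if \<psi>: "\<psi> \<in> Diff_Holder_normalized \<alpha>" and ball: "\<psi> \<in> deriv_ball \<alpha> \<phi> (\<epsilon> / (3 * D))" for \<psi>
  proof -
    let ?g = "normalized_lift \<psi>"
    note g = normalized_lift_facts[OF \<psi> \<open>0 < \<alpha>\<close>]
    have "\<exists>M<\<epsilon> / (3 * D). holder_bounded \<alpha> M (\<lambda>x. deriv ?g x - deriv ?f x)"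
      using ball unfolding deriv_ball_def mem_Collect_eq f(4) g(4) by (rule conjunct2)
    then obtain M where M: "M < \<epsilon> / (3 * D)" "holder_bounded \<alpha> M (\<lambda>x. deriv ?g x - deriv ?f x)"
      by (elim exE conjE)
    note M_nonneg = holder_bounded_nonneg[OF M(2)]
    have "norm (cis (?g (inv ?f x)) - cis x) \<le> D * M" for x
    proof -
      have "norm (cis (?g (inv ?f x)) - cis (?f (inv ?f x))) \<le> \<bar>?g (inv ?f x) - ?f (inv ?f x)\<bar>"
        by (rule norm_cis_diff_le)
      also have "\<dots> \<le> 2 * pi * M"
        by (rule normalized_lifts_close[OF f(3,5) g(3,5) M(2)])
      also have "\<dots> \<le> D * M"
        using D M_nonneg by (intro mult_right_mono)
      finally show ?thesis
        using holder_lift_bij[OF f(3)] by (simp add: bij_is_surj surj_f_inv_f)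
    qed
    moreover have "holder_bounded \<alpha> (D * M) (\<lambda>x. deriv ?g (inv ?f x) / deriv ?f (inv ?f x) - 1)"
      by (rule holder_bounded_mono[OF C(2)[OF M(2)]]) (use D M_nonneg in \<open>intro mult_right_mono\<close>)
    ultimately have "p_Holder \<alpha> (compose circle \<psi> (inv_into circle \<phi>)) \<le> 3 * (D * M)"
      by (intro p_Holder_le[OF is_lift_quotient[OF f(1,2) g(1,2) \<open>0 < \<alpha>\<close>]])
         (simp_all add: deriv_quotient[OF f(3) g(3)])
    also have "\<dots> < \<epsilon>"
      using M(1) D(1) by (simp add: field_simps)
    finally show ?thesis .
  qed
  then show thesis
    using D(1) \<open>0 < \<epsilon>\<close> by (intro that[of "\<epsilon> / (3 * D)"]) auto
qed

section \<open>The straight-line contraction\<close>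

lemma holder_lift_convex:
  assumes f: "holder_lift \<alpha> f" and g: "holder_lift \<alpha> g" and t: "0 \<le> t" "t \<le> 1"
  shows "holder_lift \<alpha> (\<lambda>x. (1 - t) * f x + t * g x)"
proof -
  obtain m where m: "0 < m" "\<And>x. m \<le> deriv f x"
    using f by (rule holder_lift_deriv_lower) blast
  obtain n where n: "0 < n" "\<And>x. n \<le> deriv g x"
    using g by (rule holder_lift_deriv_lower) blast
  obtain M where M: "holder_bounded \<alpha> M (deriv f)"
    using f by (rule holder_lift_deriv_holder)
  obtain N where N: "holder_bounded \<alpha> N (deriv g)"
    using g by (rule holder_lift_deriv_holder)
  show ?thesis
  proof (rule holder_liftI)
    show "((\<lambda>x. (1 - t) * f x + t * g x) has_real_derivative (1 - t) * deriv f x + t * deriv g x) (at x)" for x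
      by (intro DERIV_add DERIV_cmult holder_lift_has_derivative[OF f] holder_lift_has_derivative[OF g])
    show "0 < min m n"
      using m n by simp
    show "min m n \<le> (1 - t) * deriv f x + t * deriv g x" for x
    proof -
      have "(1 - t) * min m n + t * min m n \<le> (1 - t) * deriv f x + t * deriv g x"
        using t m(2)[of x] n(2)[of x] by (intro add_mono mult_left_mono) auto
      then show ?thesis
        by (simp add: algebra_simps)
    qed
    show "holder_bounded \<alpha> (\<bar>1 - t\<bar> * M + \<bar>t\<bar> * N) (\<lambda>x. (1 - t) * deriv f x + t * deriv g x)"
      by (intro holder_bounded_add holder_bounded_scale M N)
    show "(1 - t) * f (x + 2 * pi) + t * g (x + 2 * pi) = (1 - t) * f x + t * g x + 2 * pi" for x
      unfolding holder_lift_period[OF f] holder_lift_period[OF g] by (simp add: algebra_simps)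
  qed
qed

definition contract :: "real \<Rightarrow> (complex \<Rightarrow> complex) \<Rightarrow> complex \<Rightarrow> complex" where
  "contract t \<phi> = circle_map (\<lambda>x. (1 - t) * normalized_lift \<phi> x + t * x)"

lemma holder_lift_contract:
  assumes "\<phi> \<in> Diff_Holder_normalized \<alpha>" "0 < \<alpha>" "0 \<le> t" "t \<le> 1"
  shows "holder_lift \<alpha> (\<lambda>x. (1 - t) * normalized_lift \<phi> x + t * x)"
  using holder_lift_convex[OF normalized_lift_facts(3)[OF assms(1,2)] holder_lift_id assms(3,4)] .

lemma contract_in_Diff_Holder_normalized:
  assumes \<phi>: "\<phi> \<in> Diff_Holder_normalized \<alpha>" "0 < \<alpha>" and t: "0 \<le> t" "t \<le> 1"
  shows "contract t \<phi> \<in> Diff_Holder_normalized \<alpha>"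
proof -
  note lift = holder_lift_contract[OF \<phi> t]
  have cis_i: "cis (pi / 2) = \<i>" "cis pi = - 1" by simp_all
  have "normalized_lift \<phi> (pi / 2) = pi / 2" "normalized_lift \<phi> pi = pi"
    by (rule normalized_lift_fixed_point[OF \<phi>];
        use \<phi>(1) in \<open>simp add: Diff_Holder_normalized_def\<close>)+
  moreover note normalized_lift_facts(5)[OF \<phi>]
  moreover have "(1 - t) * normalized_lift \<phi> x + t * x = x" if "normalized_lift \<phi> x = x" for x
    using that by (simp add: algebra_simps)
  ultimately have "contract t \<phi> (cis 0) = cis 0" "contract t \<phi> (cis (pi / 2)) = cis (pi / 2)"
    "contract t \<phi> (cis pi) = cis pi"
    unfolding contract_def circle_map_cis[OF lift] by presburger+
  then show ?thesis
    using circle_map_in_Diff_Holder[OF lift \<phi>(2)]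
    by (simp add: Diff_Holder_normalized_def cis_i contract_def)
qed

lemma deriv_the_lift_contract:
  assumes \<phi>: "\<phi> \<in> Diff_Holder_normalized \<alpha>" "0 < \<alpha>" and t: "0 \<le> t" "t \<le> 1"
  shows "deriv (the_lift (contract t \<phi>)) x = (1 - t) * deriv (the_lift \<phi>) x + t"
proof -
  note f = normalized_lift_facts[OF \<phi>]
  have "((\<lambda>x. (1 - t) * normalized_lift \<phi> x + t * x) has_real_derivative
      (1 - t) * deriv (normalized_lift \<phi>) x + t * 1) (at x)"
    by (intro DERIV_add DERIV_cmult DERIV_ident holder_lift_has_derivative[OF f(3)])
  then have "deriv (\<lambda>x. (1 - t) * normalized_lift \<phi> x + t * x) x = (1 - t) * deriv (normalized_lift \<phi>) x + t"
    using DERIV_imp_deriv by fastforce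
  then show ?thesis
    unfolding contract_def f(4) deriv_the_lift[OF is_lift_circle_map[OF holder_lift_contract[OF \<phi> t]]] .
qed

lemma contract_0:
  assumes \<phi>: "\<phi> \<in> Diff_Holder_normalized \<alpha>" "0 < \<alpha>"
  shows "contract 0 \<phi> = \<phi>"
proof (rule extensionalityI)
  show "contract 0 \<phi> \<in> extensional circle"
    by (simp add: contract_def circle_map_def)
  show "\<phi> \<in> extensional circle"
    using \<phi> by (simp add: Diff_Holder_normalized_def Diff_Holder_def)
  fix z assume "z \<in> circle"
  then obtain x where x: "z = cis x"
    by (rule circle_cisE)
  have "contract 0 \<phi> (cis x) = cis (normalized_lift \<phi> x)"
    using circle_map_cis[OF holder_lift_contract[OF \<phi>, of 0]] by (simp add: contract_def)
  then show "contract 0 \<phi> z = \<phi> z"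
    using normalized_lift_facts(2)[OF \<phi>] by (simp add: x is_lift_def)
qed

text \<open>The difference of the derivatives of the two contracted lifts is
  \<open>(1 - t) * (g' - f') + (s - t) * (f' - 1)\<close>, with \<open>f\<close> and \<open>g\<close> the lifts of \<open>\<phi>\<close> and \<open>\<psi>\<close>.\<close>

lemma contract_in_deriv_ball:
  assumes \<phi>: "\<phi> \<in> Diff_Holder_normalized \<alpha>" and \<psi>: "\<psi> \<in> Diff_Holder_normalized \<alpha>" and "0 < \<alpha>"
    and s: "0 \<le> s" "s \<le> 1" and t: "0 \<le> t" "t \<le> 1"
    and N: "holder_bounded \<alpha> N (\<lambda>x. deriv (the_lift \<phi>) x - 1)"
    and ball: "\<psi> \<in> deriv_ball \<alpha> \<phi> \<delta>"
  shows "contract t \<psi> \<in> deriv_ball \<alpha> (contract s \<phi>) (\<delta> + \<bar>s - t\<bar> * N)"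
proof -
  obtain M where M: "M < \<delta>" "holder_bounded \<alpha> M (\<lambda>x. deriv (the_lift \<psi>) x - deriv (the_lift \<phi>) x)"
    using ball by (auto simp: deriv_ball_def)
  have "holder_bounded \<alpha> (\<bar>1 - t\<bar> * M + \<bar>s - t\<bar> * N)
     (\<lambda>x. (1 - t) * (deriv (the_lift \<psi>) x - deriv (the_lift \<phi>) x) + (s - t) * (deriv (the_lift \<phi>) x - 1))"
    by (intro holder_bounded_add holder_bounded_scale M N)
  also have "(\<lambda>x. (1 - t) * (deriv (the_lift \<psi>) x - deriv (the_lift \<phi>) x) + (s - t) * (deriv (the_lift \<phi>) x - 1))
     = (\<lambda>x. deriv (the_lift (contract t \<psi>)) x - deriv (the_lift (contract s \<phi>)) x)"
    unfolding deriv_the_lift_contract[OF \<psi> \<open>0 < \<alpha>\<close> t] deriv_the_lift_contract[OF \<phi> \<open>0 < \<alpha>\<close> s]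
    by (simp add: algebra_simps)
  finally have "holder_bounded \<alpha> (\<bar>1 - t\<bar> * M + \<bar>s - t\<bar> * N)
     (\<lambda>x. deriv (the_lift (contract t \<psi>)) x - deriv (the_lift (contract s \<phi>)) x)" .
  moreover have "\<bar>1 - t\<bar> * M + \<bar>s - t\<bar> * N < \<delta> + \<bar>s - t\<bar> * N"
    using M(1) mult_right_mono[of "\<bar>1 - t\<bar>" 1 M] holder_bounded_nonneg[OF M(2)] t by simp
  moreover have "contract t \<psi> \<in> Diff_Holder \<alpha>"
    using contract_in_Diff_Holder_normalized[OF \<psi> \<open>0 < \<alpha>\<close> t] by (simp add: Diff_Holder_normalized_def)
  ultimately show ?thesis
    unfolding deriv_ball_def by blast
qed

lemma topspace_Teichmuller_space: "topspace (Teichmuller_space \<alpha>) = Diff_Holder_normalized \<alpha>"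
  by (auto simp: Teichmuller_space_def Diff_Holder_normalized_def)

text \<open>Near \<open>(s, \<phi>)\<close>, half of the available distance \<open>\<delta>\<close> is used for moving \<open>\<phi>\<close> and half for moving \<open>s\<close>.
  The former is an open condition on \<open>\<phi>\<close> by \<open>openin_deriv_ball\<close>.\<close>

lemma continuous_map_contract:
  assumes "0 < \<alpha>"
  shows "continuous_map (prod_topology (top_of_set {0..1}) (Teichmuller_space \<alpha>)) (Teichmuller_space \<alpha>)
    (\<lambda>(t, \<phi>). contract t \<phi>)"
proof -
  let ?T = "Teichmuller_space \<alpha>" and ?X = "prod_topology (top_of_set {0..1::real}) (Teichmuller_space \<alpha>)"
  let ?N = "Diff_Holder_normalized \<alpha>"
  have X: "topspace ?X = {0..1} \<times> ?N"
    by (simp add: topspace_Teichmuller_space)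
  have "openin ?X {p \<in> topspace ?X. (case p of (t, \<phi>) \<Rightarrow> contract t \<phi>) \<in> V}" if V: "openin ?T V" for V
  proof (subst openin_subopen, intro ballI)
    obtain U where U: "openin (right_uniform_topology \<alpha>) U" "V = U \<inter> ?N"
      using V by (auto simp: Teichmuller_space_def openin_subtopology)
    fix p assume "p \<in> {p \<in> topspace ?X. (case p of (t, \<phi>) \<Rightarrow> contract t \<phi>) \<in> V}"
    then obtain s \<phi> where p: "p = (s, \<phi>)" and s: "0 \<le> s" "s \<le> 1" and \<phi>: "\<phi> \<in> ?N"
      and sV: "contract s \<phi> \<in> U"
      using U(2) unfolding X by auto
    obtain \<epsilon> where \<epsilon>: "0 < \<epsilon>" "\<And>\<psi>. \<psi> \<in> Diff_Holder \<alpha> \<Longrightarrow>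
        p_Holder \<alpha> (compose circle \<psi> (inv_into circle (contract s \<phi>))) < \<epsilon> \<Longrightarrow> \<psi> \<in> U"
      using U(1) sV unfolding openin_right_uniform_topology by blast
    obtain \<delta> where \<delta>: "0 < \<delta>" "\<And>\<psi>. \<psi> \<in> ?N \<Longrightarrow> \<psi> \<in> deriv_ball \<alpha> (contract s \<phi>) \<delta> \<Longrightarrow>
        p_Holder \<alpha> (compose circle \<psi> (inv_into circle (contract s \<phi>))) < \<epsilon>"
      using contract_in_Diff_Holder_normalized[OF \<phi> assms s] assms \<epsilon>(1)
      by (rule deriv_ball_in_p_Holder_ball) blast
    obtain K where "holder_bounded \<alpha> K (deriv (normalized_lift \<phi>))"
      using normalized_lift_facts(3)[OF \<phi> assms] by (rule holder_lift_deriv_holder)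
    from holder_bounded_diff[OF this holder_bounded_const[of \<alpha> 1]]
    obtain N where N: "holder_bounded \<alpha> N (\<lambda>x. deriv (the_lift \<phi>) x - 1)"
      unfolding normalized_lift_facts(4)[OF \<phi> assms] by blast
    note N_nonneg = holder_bounded_nonneg[OF N]
    define r where "r = \<delta> / (2 * (N + 1))"
    have r: "0 < r" "r * N \<le> \<delta> / 2"
      using \<delta>(1) N_nonneg by (auto simp: r_def field_simps)
    define W where "W = ({0..1} \<inter> ball s r) \<times> (deriv_ball \<alpha> \<phi> (\<delta> / 2) \<inter> ?N)"
    have "openin (top_of_set {0..1}) ({0..1} \<inter> ball s r)"
      by (rule openin_open_Int) simp
    moreover have "openin ?T (deriv_ball \<alpha> \<phi> (\<delta> / 2) \<inter> ?N)"
      unfolding Teichmuller_space_def openin_subtopology using openin_deriv_ball[OF assms] by blast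
    ultimately have "openin ?X W"
      unfolding W_def by (simp add: openin_prod_Times_iff)
    moreover have "p \<in> W"
      using s r(1) \<phi> \<delta>(1) center_in_deriv_ball[of \<phi> \<alpha> "\<delta> / 2"]
      by (simp add: W_def p Diff_Holder_normalized_def)
    moreover have "contract t \<psi> \<in> V" if "(t, \<psi>) \<in> W" for t \<psi>
    proof -
      have t: "0 \<le> t" "t \<le> 1" "\<bar>s - t\<bar> \<le> r" and \<psi>: "\<psi> \<in> ?N" "\<psi> \<in> deriv_ball \<alpha> \<phi> (\<delta> / 2)"
        using that by (auto simp: W_def dist_real_def)
      have "\<bar>s - t\<bar> * N \<le> r * N"
        using t N_nonneg by (intro mult_right_mono)
      then have "\<delta> / 2 + \<bar>s - t\<bar> * N \<le> \<delta>"
        using r(2) by linarith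
      then have "contract t \<psi> \<in> deriv_ball \<alpha> (contract s \<phi>) \<delta>"
        using contract_in_deriv_ball[OF \<phi> \<psi>(1) assms s t(1,2) N \<psi>(2)] less_le_trans
        unfolding deriv_ball_def by blast
      moreover have "contract t \<psi> \<in> ?N"
        using contract_in_Diff_Holder_normalized[OF \<psi>(1) assms t(1,2)] .
      ultimately show ?thesis
        using \<epsilon>(2) \<delta>(2) U(2) by (auto simp: Diff_Holder_normalized_def)
    qed
    ultimately show "\<exists>W. openin ?X W \<and> p \<in> W \<and>
        W \<subseteq> {p \<in> topspace ?X. (case p of (t, \<phi>) \<Rightarrow> contract t \<phi>) \<in> V}"
      using openin_subset[of ?X W] by (intro exI[of _ W]) auto
  qed
  moreover have "(\<lambda>(t, \<phi>). contract t \<phi>) \<in> topspace ?X \<rightarrow> topspace ?T"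
    unfolding X topspace_Teichmuller_space using contract_in_Diff_Holder_normalized assms by auto
  ultimately show ?thesis
    unfolding continuous_map_def by blast
qed

theorem corollary1p2:
  fixes \<alpha> :: real
  assumes "0 < \<alpha>" and "\<alpha> < 1"
  shows "contractible_space (Teichmuller_space \<alpha>)"
proof -
  let ?T = "Teichmuller_space \<alpha>"
  have ends: "contract 0 \<phi> = id \<phi>" "contract 1 \<phi> = circle_map (\<lambda>x. x)"
    if "\<phi> \<in> topspace ?T" for \<phi>
    using that contract_0[of \<phi> \<alpha>] assms(1) by (simp_all add: topspace_Teichmuller_space contract_def)
  have "homotopic_with (\<lambda>x. True) ?T ?T id (\<lambda>x. circle_map (\<lambda>x. x))"
  proof (subst homotopic_with)
    show "\<exists>h. continuous_map (prod_topology (top_of_set {0..1::real}) ?T) ?T h \<and>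
        (\<forall>\<phi>\<in>topspace ?T. h (0, \<phi>) = id \<phi>) \<and>
        (\<forall>\<phi>\<in>topspace ?T. h (1, \<phi>) = circle_map (\<lambda>x. x)) \<and> (\<forall>t\<in>{0..1}. True)"
      using continuous_map_contract[OF assms(1)] ends
      by (intro exI[of _ "\<lambda>(t, \<phi>). contract t \<phi>"]) simp
  qed simp
  then show ?thesis
    unfolding contractible_space_def by blast
qed

end
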